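(* Let $(n_{k})_{k\ge 0}$ be a strictly increasing sequence of integers. Suppose that the set $$C=\{\lambda\in\mathbb{T} : \lambda^{n_{k}}\to 1 \text{ as } k\to+\infty\}$$ is dense in $\mathbb{T}$. Then for every $\varepsilon>0$ there exists a continuous Borel probability measure $\mu$ on $\mathbb{T}$ such that $\widehat{\mu}(n_{k})\to 1$ as $k\to+\infty$ and $\sup_{k\ge 0}|\widehat{\mu}(n_{k})-1|<\varepsilon$. In particular, $\{n_{k} : k\ge 0\}$ is a non-Kazhdan subset of $\mathbb{Z}$ (that is, it is not a Kazhdan subset of $\mathbb{Z}$).
   Context: $\mathbb{T}=\{\lambda\in\mathbb{C} : |\lambda|=1\}$. For a finite complex Borel measure $\mu$ on $\mathbb{T}$ and $n\in\mathbb{Z}$, $\widehat{\mu}(n)=\int_{\mathbb{T}}\lambda^{n}\,d\mu(\lambda)$. A Borel probability measure $\mu$ on $\mathbb{T}$ is continuous if $\mu(\{\lambda\})=0$ for every $\lambda\in\mathbb{T}$. A subset $Q\subseteq\mathbb{Z}$ is a Kazhdan subset of $\mathbb{Z}$ if there exists $\varepsilon>0$ such that every unitary operator $U$ acting on a complex separable Hilbert space $H$ has the following property: if there is $x\in H$ with $\|x\|=1$ and $\sup_{n\in Q}\|U^{n}x-x\|<\varepsilon$, then there is a non-zero $y\in H$ with $Uy=y$. *)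

theory Defs
  imports "HOL-Algebra.Algebraic_Closure_Type" "HOL-Probability.Probability_Measure"
begin

section \<open>Complex Hilbert spaces\<close>

text \<open>
  Hilbert spaces are carrier-based structures, since the notion of Kazhdan set quantifies over all
  of them inside a formula. The multiplicative part of the \<^typ>\<open>('c, 'a) module\<close> record plays no
  role. The inner product is linear in its first argument.
\<close>

record 'a inner_product_module = "(complex, 'a) module" +
  cinner :: "'a \<Rightarrow> 'a \<Rightarrow> complex"

definition cnorm :: "('a, 'm) inner_product_module_scheme \<Rightarrow> 'a \<Rightarrow> real" where
  "cnorm V x = sqrt (Re (cinner V x x))"

text \<open>The value off the carrier is fixed because \<^locale>\<open>Metric_space\<close> requires nonnegativity and
  symmetry for all arguments, not only for points of the space.\<close>

definition cdist :: "('a, 'm) inner_product_module_scheme \<Rightarrow> 'a \<Rightarrow> 'a \<Rightarrow> real" where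
  "cdist V x y = (if x \<in> carrier V \<and> y \<in> carrier V then cnorm V (x \<ominus>\<^bsub>V\<^esub> y) else 0)"

locale complex_inner_product_space =
  Module.module "ring_of_type_algebra :: complex ring" V
  for V :: "('a, 'm) inner_product_module_scheme" (structure) +
  assumes cinner_add_left:
      "\<lbrakk>x \<in> carrier V; y \<in> carrier V; z \<in> carrier V\<rbrakk>
        \<Longrightarrow> cinner V (x \<oplus>\<^bsub>V\<^esub> y) z = cinner V x z + cinner V y z"
    and cinner_smult_left:
      "\<lbrakk>x \<in> carrier V; y \<in> carrier V\<rbrakk> \<Longrightarrow> cinner V (a \<odot>\<^bsub>V\<^esub> x) y = a * cinner V x y"
    and cinner_commute:
      "\<lbrakk>x \<in> carrier V; y \<in> carrier V\<rbrakk> \<Longrightarrow> cinner V y x = cnj (cinner V x y)"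
    and cinner_nonneg: "x \<in> carrier V \<Longrightarrow> Re (cinner V x x) \<ge> 0"
    and cinner_definite: "\<lbrakk>x \<in> carrier V; cinner V x x = 0\<rbrakk> \<Longrightarrow> x = \<zero>\<^bsub>V\<^esub>"

locale separable_complex_hilbert_space = complex_inner_product_space +
  assumes complete: "Metric_space.mcomplete (carrier V) (cdist V)"
    and separable: "separable_space (Metric_space.mtopology (carrier V) (cdist V))"


section \<open>Unitary operators and Kazhdan subsets of the integers\<close>

definition unitary_operator ::
    "('a, 'm) inner_product_module_scheme \<Rightarrow> ('a \<Rightarrow> 'a) \<Rightarrow> bool" where
  "unitary_operator V U \<longleftrightarrow>
     bij_betw U (carrier V) (carrier V) \<and>
     (\<forall>x\<in>carrier V. \<forall>y\<in>carrier V. U (x \<oplus>\<^bsub>V\<^esub> y) = U x \<oplus>\<^bsub>V\<^esub> U y) \<and>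
     (\<forall>a. \<forall>x\<in>carrier V. U (a \<odot>\<^bsub>V\<^esub> x) = a \<odot>\<^bsub>V\<^esub> U x) \<and>
     (\<forall>x\<in>carrier V. \<forall>y\<in>carrier V. cinner V (U x) (U y) = cinner V x y)"

definition operator_powi ::
    "('a, 'm) inner_product_module_scheme \<Rightarrow> ('a \<Rightarrow> 'a) \<Rightarrow> int \<Rightarrow> 'a \<Rightarrow> 'a" where
  "operator_powi V U n =
     (if n \<ge> 0 then U ^^ nat n else inv_into (carrier V) U ^^ nat (- n))"

text \<open>The supremum is taken in \<^typ>\<open>ennreal\<close> so that it is always meaningful; in particular it is
  \<open>0\<close> for the empty set.\<close>

definition kazhdan_property ::
    "('a, 'm) inner_product_module_scheme \<Rightarrow> int set \<Rightarrow> real \<Rightarrow> bool" where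
  "kazhdan_property V Q \<epsilon> \<longleftrightarrow>
     (\<forall>U. unitary_operator V U \<longrightarrow>
       (\<exists>x\<in>carrier V. cnorm V x = 1 \<and>
          (SUP n\<in>Q. ennreal (cnorm V (operator_powi V U n x \<ominus>\<^bsub>V\<^esub> x))) < ennreal \<epsilon>) \<longrightarrow>
       (\<exists>y\<in>carrier V. y \<noteq> \<zero>\<^bsub>V\<^esub> \<and> U y = y))"

text \<open>
  HOL cannot quantify over the type of the vectors inside a formula. Letting the carrier range over
  all subsets of \<^typ>\<open>nat \<Rightarrow> complex\<close> loses no generality: if \<open>d\<close> enumerates a dense subset of a
  separable Hilbert space \<open>V\<close>, then \<open>v \<mapsto> (\<lambda>i. cinner V v (d i))\<close> is injective on \<open>carrier V\<close>,
  and transporting the structure along it gives an isomorphic space of the form considered here.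
\<close>

definition kazhdan_subset :: "int set \<Rightarrow> bool" where
  "kazhdan_subset Q \<longleftrightarrow>
     (\<exists>\<epsilon>>0. \<forall>V :: (nat \<Rightarrow> complex) inner_product_module.
        separable_complex_hilbert_space V \<longrightarrow> kazhdan_property V Q \<epsilon>)"


section \<open>Measures on the unit circle\<close>

abbreviation unit_circle :: "complex set" where
  "unit_circle \<equiv> sphere 0 1"

definition circle_prob_measure :: "complex measure \<Rightarrow> bool" where
  "circle_prob_measure \<mu> \<longleftrightarrow>
     prob_space \<mu> \<and> sets \<mu> = sets (restrict_space borel unit_circle)"

definition continuous_measure :: "complex measure \<Rightarrow> bool" where
  "continuous_measure \<mu> \<longleftrightarrow> (\<forall>z\<in>unit_circle. emeasure \<mu> {z} = 0)"

text \<open>The exponent is \<open>n\<close>, not \<open>- n\<close>.\<close>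

definition fourier_coeff :: "complex measure \<Rightarrow> int \<Rightarrow> complex" where
  "fourier_coeff \<mu> n = (\<integral>z. z powi n \<partial>\<mu>)"

end

theory Submission
  imports Defs "HOL-Probability.Probability"
begin

text \<open>
  Choose angles \<open>\<theta>\<^sub>j\<close> with \<open>cis \<theta>\<^sub>j \<in> C\<close>, decreasing so fast that for every \<open>k\<close> all but at most one \<open>j\<close>
  satisfy \<open>|cis \<theta>\<^sub>j ^ n\<^sub>k - 1| \<le> 2 ^ (-j)\<close>. For independent Bernoulli variables \<open>\<omega>\<^sub>j\<close> with parameters
  \<open>p\<^sub>j = c / (j + 1)\<close>, let \<open>\<mu>\<close> be the law of \<open>cis (\<Sum>j. \<omega>\<^sub>j \<theta>\<^sub>j)\<close>. Since \<open>\<Sum>j. p\<^sub>j\<close> diverges and the \<open>\<omega>\<^sub>j\<close> can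
  be read off the value, \<open>\<mu>\<close> has no atoms. Its Fourier coefficient at \<open>n\<^sub>k\<close> is within
  \<open>\<Sum>j. p\<^sub>j |cis \<theta>\<^sub>j ^ n\<^sub>k - 1|\<close> of \<open>1\<close>, and the single bad index contributes at most \<open>2 p\<^sub>j\<close>, which is at
  most \<open>2 c\<close> and tends to \<open>0\<close> as \<open>j\<close> grows.

  The Kazhdan property already fails in finite dimension: for the diagonal unitary with entries
  \<open>cis \<theta>\<^sub>j\<close>, \<open>j < N\<close>, the normalised constant vector is moved by \<open>O(1 / sqrt N)\<close> under all powers
  \<open>n\<^sub>k\<close>, while no entry equals \<open>1\<close>.
\<close>

section \<open>Lacunary angles\<close>

lemma cmod_cis_minus_1_le: "cmod (cis t - 1) \<le> \<bar>t\<bar>"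
  using dist_exp_i_1[of t] abs_sin_x_le_abs_x[of "t / 2"] by (simp add: cis_conv_exp)

lemma cmod_cis_minus_1_le_2: "cmod (cis t - 1) \<le> 2"
  using norm_triangle_ineq4[of "cis t" 1] by simp

lemma dense_in_circle_small_angle:
  assumes C: "closure C = unit_circle" and "\<delta> > 0"
  obtains t where "0 < t" "t < \<delta>" "cis t \<in> C"
proof -
  \<comment> \<open>The cap at \<open>1\<close> keeps \<open>cis s\<close> off the negative real
    axis, where \<open>Arg\<close> jumps. By continuity a point of \<open>C\<close> near
    \<open>cis s\<close> has argument within \<open>s\<close> of \<open>s\<close>, hence in
    \<open>(0, 2 * s)\<close>, and \<open>2 * s\<close> is at most \<open>\<delta>\<close>.\<close>
  define s where "s = min \<delta> 1 / 2"
  have s: "0 < s" "s < \<delta>" "s \<le> 1/2" using \<open>\<delta> > 0\<close> by (auto simp: s_def)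
  have Arg: "Arg (cis s) = s" using s pi_gt3 by (intro Arg_cis) auto
  have "sin s > 0" using s pi_gt3 by (intro sin_gt_zero) auto
  hence "cis s \<notin> \<real>\<^sub>\<le>\<^sub>0" by (simp add: complex_nonpos_Reals_iff)
  hence "continuous (at (cis s)) Arg" by (rule continuous_at_Arg)
  then obtain d where d: "d > 0" "\<And>z. dist z (cis s) < d \<Longrightarrow> dist (Arg z) s < s"
    using s unfolding continuous_at_eps_delta by (metis Arg)
  have "cis s \<in> closure C" using C by simp
  then obtain z where z: "z \<in> C" "dist z (cis s) < d"
    using d(1) closure_approachable by blast
  have "z \<in> unit_circle" using z C closure_subset by blast
  hence "cis (Arg z) = z" using rcis_cmod_Arg[of z] by (simp add: rcis_def)
  moreover have "0 < Arg z" "Arg z < \<delta>"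
    using d(2)[OF z(2)] min.cobounded1[of \<delta> 1] unfolding dist_real_def abs_less_iff s_def
    by linarith+
  ultimately show ?thesis using that[of "Arg z"] z by simp
qed

text \<open>With ratio 1/3 the angles after \<open>\<theta> m\<close> add up to at most half of
  \<open>\<theta> m\<close>, so later digits cannot compensate for a change of an earlier
  one.\<close>

definition lacunary :: "(nat \<Rightarrow> real) \<Rightarrow> bool" where
  "lacunary \<theta> \<longleftrightarrow> (\<forall>j. 0 < \<theta> j) \<and> (\<forall>j. \<theta> (Suc j) \<le> \<theta> j / 3)"

lemma almost_all_factors_near_1:
  fixes n :: "nat \<Rightarrow> int"
  assumes dense: "closure {z \<in> unit_circle. (\<lambda>k. z powi n k) \<longlonglongrightarrow> 1} = unit_circle"
  obtains \<theta> where "lacunary \<theta>" "\<theta> 0 < 1"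
    "\<And>j. (\<lambda>k. cis (\<theta> j) powi n k) \<longlonglongrightarrow> 1"
    "\<And>k. \<exists>j. \<forall>i. i \<noteq> j \<longrightarrow> cmod (cis (\<theta> i) powi n k - 1) \<le> (1/2) ^ i"
proof -
  txt \<open>Choose angles \<open>t\<^sub>j\<close> and ranks \<open>K\<^sub>j\<close> alternately: \<open>t\<^sub>j\<close> is good for all \<open>k \<ge> K\<^sub>j\<close>, and \<open>t\<^sub>j\<^sub>+\<^sub>1\<close>
    is so small that it is good for all \<open>k < K\<^sub>j\<close>. The only possibly bad index for \<open>k\<close> is then the
    least \<open>j\<close> with \<open>k < K\<^sub>j\<close>.\<close>
  let ?P = "\<lambda>j (t, K). 0 < t \<and> t < 1 \<and> (\<lambda>k. cis t powi n k) \<longlonglongrightarrow> 1 \<and>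
              (\<forall>k\<ge>K. cmod (cis t powi n k - 1) \<le> (1/2) ^ j)"
  let ?Q = "\<lambda>j (t, K) (t', K'). t' \<le> t / 3 \<and> K \<le> K' \<and>
              (\<forall>k<K. \<bar>real_of_int (n k)\<bar> * t' \<le> (1/2) ^ Suc j)"
  have ex: "\<exists>t L. 0 < t \<and> t < \<delta> \<and> (\<lambda>k. cis t powi n k) \<longlonglongrightarrow> 1 \<and>
              K \<le> L \<and> (\<forall>k\<ge>L. cmod (cis t powi n k - 1) \<le> (1/2) ^ j)"
    if \<delta>: "\<delta> > 0" for \<delta> j and K :: nat
  proof -
    obtain t where t: "0 < t" "t < \<delta>" "(\<lambda>k. cis t powi n k) \<longlonglongrightarrow> 1"
      using dense_in_circle_small_angle[OF dense \<delta>] by blast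
    obtain L where L: "\<And>k. k \<ge> L \<Longrightarrow> cmod (cis t powi n k - 1) < (1/2) ^ j"
      using LIMSEQ_D[OF t(3), of "(1/2) ^ j"] by auto
    show ?thesis
      using t L by (intro exI[of _ t] exI[of _ "max K L"]) (auto intro: less_imp_le)
  qed
  have "\<exists>f. \<forall>j. ?P j (f j) \<and> ?Q j (f j) (f (Suc j))"
  proof (rule dependent_nat_choice)
    show "\<exists>x. ?P 0 x" using ex[of 1 0 0] by auto
  next
    fix x j
    assume x: "?P j x"
    obtain t K where [simp]: "x = (t, K)" by (cases x)
    \<comment> \<open>A common bound for the finitely many exponents before rank \<open>K\<close>;
      the added \<open>1\<close> makes it a positive denominator.\<close>
    define B where "B = (\<Sum>k<K. \<bar>real_of_int (n k)\<bar>) + 1"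
    have B: "B > 0" unfolding B_def by (intro add_nonneg_pos sum_nonneg) auto
    have nB: "\<bar>real_of_int (n k)\<bar> \<le> B" if "k < K" for k
      using member_le_sum[of k "{..<K}" "\<lambda>k. \<bar>real_of_int (n k)\<bar>"] that by (simp add: B_def)
    \<comment> \<open>The first entry forces the lacunary ratio, the second makes the new angle good
      for all ranks below \<open>K\<close>.\<close>
    define \<delta> where "\<delta> = min (t / 3) ((1/2) ^ Suc j / B)"
    have "\<delta> > 0" using x B by (auto simp: \<delta>_def)
    from ex[OF this, of K "Suc j"] obtain t' K' where t': "0 < t'" "t' < \<delta>"
        "(\<lambda>k. cis t' powi n k) \<longlonglongrightarrow> 1" "K \<le> K'"
        "\<forall>k\<ge>K'. cmod (cis t' powi n k - 1) \<le> (1/2) ^ Suc j" by blast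
    have "\<bar>real_of_int (n k)\<bar> * t' \<le> (1/2) ^ Suc j" if "k < K" for k
    proof -
      have "\<bar>real_of_int (n k)\<bar> * t' \<le> B * ((1/2) ^ Suc j / B)"
        using nB[OF that] t' by (intro mult_mono) (auto simp: \<delta>_def)
      thus ?thesis using B by simp
    qed
    moreover have "t' \<le> t / 3" "t' < 1" using t' x by (auto simp: \<delta>_def)
    ultimately show "\<exists>y. ?P (Suc j) y \<and> ?Q j x y"
      using t' unfolding \<open>x = (t, K)\<close> by (intro exI[of _ "(t', K')"]) (unfold prod.case, blast)
  qed
  then obtain f where f: "\<forall>j. ?P j (f j) \<and> ?Q j (f j) (f (Suc j))" ..
  define \<theta> K where "\<theta> = fst \<circ> f" and "K = snd \<circ> f"
  have f': "?P j (\<theta> j, K j)" "?Q j (\<theta> j, K j) (\<theta> (Suc j), K (Suc j))" for j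
    unfolding \<theta>_def K_def o_apply prod.collapse
    by (rule f[THEN spec, THEN conjunct1] f[THEN spec, THEN conjunct2])+
  have P: "0 < \<theta> j" "\<theta> j < 1" "(\<lambda>k. cis (\<theta> j) powi n k) \<longlonglongrightarrow> 1"
      "\<And>k. k \<ge> K j \<Longrightarrow> cmod (cis (\<theta> j) powi n k - 1) \<le> (1/2) ^ j"
    and Q: "\<theta> (Suc j) \<le> \<theta> j / 3" "K j \<le> K (Suc j)"
      "\<And>k. k < K j \<Longrightarrow> \<bar>real_of_int (n k)\<bar> * \<theta> (Suc j) \<le> (1/2) ^ Suc j" for j
    using f'[of j] unfolding prod.case by blast+
  have "mono K" using Q(2) by (intro mono_iff_le_Suc[THEN iffD2]) auto
  have "\<exists>j. \<forall>i. i \<noteq> j \<longrightarrow> cmod (cis (\<theta> i) powi n k - 1) \<le> (1/2) ^ i" for k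
  proof (cases "\<exists>j. k < K j")
    case True
    define j where "j = (LEAST j. k < K j)"
    have j: "k < K j" using True unfolding j_def by (rule LeastI_ex)
    have "cmod (cis (\<theta> i) powi n k - 1) \<le> (1/2) ^ i" if ij: "i \<noteq> j" for i
    proof (cases "i < j")
      case True
      hence "\<not> k < K i" unfolding j_def by (rule not_less_Least)
      thus ?thesis by (intro P(4)) simp
    next
      case False
      \<comment> \<open>Now \<open>i > j\<close>, so \<open>k < K j \<le> K i'\<close>, and
        \<open>\<theta> (Suc i')\<close> was chosen small against all exponents of rank below
        \<open>K i'\<close>.\<close>
      then obtain i' where i': "i = Suc i'" "j \<le> i'" using ij by (cases i) auto
      have "cmod (cis (\<theta> i) powi n k - 1) \<le> \<bar>real_of_int (n k) * \<theta> i\<bar>"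
        unfolding cis_power_int by (rule cmod_cis_minus_1_le)
      also have "\<dots> = \<bar>real_of_int (n k)\<bar> * \<theta> i" using P(1)[of i] by (simp add: abs_mult)
      also have "\<dots> \<le> (1/2) ^ i"
        unfolding i' using j monoD[OF \<open>mono K\<close> i'(2)] by (intro Q(3)) simp
      finally show ?thesis .
    qed
    thus ?thesis by blast
  next
    case False
    \<comment> \<open>No threshold exceeds \<open>k\<close>, so every index is good and the exempted
      one is arbitrary.\<close>
    thus ?thesis by (intro exI[of _ 0]) (auto intro!: P(4) simp: not_less)
  qed
  moreover have "lacunary \<theta>" using P Q by (simp add: lacunary_def)
  ultimately show ?thesis using that P by blast
qed

section \<open>Digit expansions with respect to lacunary angles\<close>

lemma lacunary_le:
  assumes "lacunary \<theta>"
  shows "\<theta> (m + i) \<le> \<theta> m * (1/3) ^ i"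
proof (induction i)
  case (Suc i)
  have "\<theta> (m + Suc i) \<le> \<theta> (m + i) / 3" using assms by (simp add: lacunary_def)
  with Suc show ?case by simp
qed simp

lemma summable_lacunary:
  assumes "lacunary \<theta>"
  shows "summable \<theta>"
proof (rule summable_comparison_test')
  show "summable (\<lambda>i. \<theta> 0 * (1/3) ^ i)" by (intro summable_mult summable_geometric) simp
  show "norm (\<theta> i) \<le> \<theta> 0 * (1/3) ^ i" if "i \<ge> 0" for i
    using lacunary_le[OF assms, of 0 i] assms by (auto simp: lacunary_def less_imp_le)
qed

lemma summable_lacunary_digits:
  assumes "lacunary \<theta>" "\<And>j. \<bar>d j\<bar> \<le> 1"
  shows "summable (\<lambda>j. \<theta> j * d j)"
  using assms
  by (intro summable_comparison_test'[OF summable_lacunary[OF assms(1)], of 0])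
     (auto simp: lacunary_def abs_mult mult_left_le less_imp_le)

text \<open>Domination by a geometric series of ratio 1/3, whose sum is 3/2. Signed digits are
  allowed because differences of two 0-1 sequences are estimated too.\<close>

lemma lacunary_tail_le:
  assumes l: "lacunary \<theta>" and d: "\<And>j. \<bar>d j\<bar> \<le> 1"
  shows "\<bar>\<Sum>j. \<theta> (m + j) * d j\<bar> \<le> 3/2 * \<theta> m"
proof -
  have "\<bar>\<theta> (m + j) * d j\<bar> \<le> \<theta> m * (1/3) ^ j" for j
  proof -
    have "\<bar>\<theta> (m + j) * d j\<bar> \<le> \<theta> (m + j) * 1"
      using l d[of j] by (auto simp: abs_mult lacunary_def less_imp_le intro!: mult_mono)
    thus ?thesis using lacunary_le[OF l, of m j] by simp
  qed
  moreover have "(\<lambda>j. \<theta> m * (1/3) ^ j) sums (\<theta> m * (3/2))"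
    using sums_mult[OF geometric_sums[of "1/3 :: real"], of "\<theta> m"] by simp
  ultimately have "norm (\<Sum>j. \<theta> (m + j) * d j) \<le> \<theta> m * (3/2)"
    using norm_suminf_le[of "\<lambda>j. \<theta> (m + j) * d j" "\<lambda>j. \<theta> m * (1/3) ^ j"]
    by (simp add: sums_iff)
  thus ?thesis by simp
qed

text \<open>At the first index \<open>m\<close> where two digit sequences differ, the sums gain a
  difference of size \<open>\<theta> m\<close>; all later terms contribute at most
  \<open>3/2 * \<theta> (Suc m)\<close>, which is at most half of that.\<close>

lemma inj_lacunary_digits:
  assumes l: "lacunary \<theta>"
  shows "inj (\<lambda>\<omega>. \<Sum>j. \<theta> j * of_bool (\<omega> j))"
proof (rule injI, rule ccontr)
  fix \<omega> \<omega>' :: "nat \<Rightarrow> bool"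
  assume eq: "(\<Sum>j. \<theta> j * of_bool (\<omega> j)) = (\<Sum>j. \<theta> j * of_bool (\<omega>' j))" and "\<omega> \<noteq> \<omega>'"
  define d :: "nat \<Rightarrow> real" where "d j = of_bool (\<omega> j) - of_bool (\<omega>' j)" for j
  define m where "m = (LEAST j. \<omega> j \<noteq> \<omega>' j)"
  have "\<exists>j. \<omega> j \<noteq> \<omega>' j" using \<open>\<omega> \<noteq> \<omega>'\<close> by auto
  hence "\<omega> m \<noteq> \<omega>' m" unfolding m_def by (rule LeastI_ex)
  hence dm: "\<bar>d m\<bar> = 1" by (auto simp: d_def)
  have d0: "d j = 0" if "j < m" for j
    using not_less_Least[of j "\<lambda>j. \<omega> j \<noteq> \<omega>' j"] that by (auto simp: m_def d_def)
  have d1: "\<bar>d j\<bar> \<le> 1" for j by (auto simp: d_def of_bool_def)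
  have sm: "summable (\<lambda>j. \<theta> j * d j)" by (rule summable_lacunary_digits[OF l d1])
  have pos: "\<theta> m > 0" using l by (simp add: lacunary_def)
  have "(\<Sum>j. \<theta> j * d j) = 0"
    unfolding d_def right_diff_distrib
    using eq by (subst suminf_diff[symmetric]) (auto intro!: summable_lacunary_digits[OF l])
  moreover have "(\<Sum>j. \<theta> j * d j) = (\<Sum>j. \<theta> (j + Suc m) * d (j + Suc m)) + \<theta> m * d m"
    by (subst suminf_split_initial_segment[OF sm, of "Suc m"]) (simp add: d0)
  moreover have "\<bar>\<Sum>j. \<theta> (j + Suc m) * d (j + Suc m)\<bar> \<le> 3/2 * \<theta> (Suc m)"
    using lacunary_tail_le[OF l, of "\<lambda>j. d (j + Suc m)" "Suc m"] d1 by (simp add: add.commute)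
  moreover have "\<theta> (Suc m) \<le> \<theta> m / 3" using l by (simp add: lacunary_def)
  moreover have "\<bar>\<theta> m * d m\<bar> = \<theta> m" using dm pos by (simp add: abs_mult)
  ultimately show False using pos by linarith
qed

text \<open>Since \<open>\<theta> 0 < 1\<close>, the digit sums have modulus below 3/2, inside the
  range where \<open>Arg\<close> inverts \<open>cis\<close>.\<close>

lemma inj_lacunary_cis:
  assumes l: "lacunary \<theta>" and "\<theta> 0 < 1"
  shows "inj (\<lambda>\<omega>. cis (\<Sum>j. \<theta> j * of_bool (\<omega> j)))"
proof (rule injI)
  fix \<omega> \<omega>' :: "nat \<Rightarrow> bool"
  assume eq: "cis (\<Sum>j. \<theta> j * of_bool (\<omega> j)) = cis (\<Sum>j. \<theta> j * of_bool (\<omega>' j))"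
  have "(\<Sum>j. \<theta> j * of_bool (\<omega> j)) \<in> {-pi<..pi}" for \<omega>
  proof -
    have "\<bar>\<Sum>j. \<theta> j * of_bool (\<omega> j)\<bar> \<le> 3/2 * \<theta> 0"
      using lacunary_tail_le[OF l, of "\<lambda>j. of_bool (\<omega> j)" 0] by simp
    also have "\<dots> < pi" using \<open>\<theta> 0 < 1\<close> pi_gt3 by simp
    finally show ?thesis unfolding greaterThanAtMost_iff by linarith
  qed
  hence "Arg (cis (\<Sum>j. \<theta> j * of_bool (\<omega> j))) = (\<Sum>j. \<theta> j * of_bool (\<omega> j))" for \<omega>
    by (rule Arg_cis)
  hence "(\<Sum>j. \<theta> j * of_bool (\<omega> j)) = (\<Sum>j. \<theta> j * of_bool (\<omega>' j))" using eq by metis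
  thus "\<omega> = \<omega>'" using injD[OF inj_lacunary_digits[OF l]] by blast
qed

text \<open>For finitely many factors of modulus 1, the distance of the product from 1 is at most
  the sum of the distances of the factors; continuity of \<open>cis\<close> passes this to the
  limit.\<close>

lemma cmod_cis_suminf_minus_1_le:
  assumes t: "summable t" and b: "summable (\<lambda>j. cmod (cis (t j) - 1))"
  shows "cmod (cis (\<Sum>j. t j) - 1) \<le> (\<Sum>j. cmod (cis (t j) - 1))"
proof (rule LIMSEQ_le_const2)
  show "(\<lambda>N. cmod (cis (\<Sum>j<N. t j) - 1)) \<longlonglongrightarrow> cmod (cis (\<Sum>j. t j) - 1)"
    using summable_LIMSEQ[OF t] by (intro tendsto_intros)
  have "cmod (cis (\<Sum>j<N. t j) - 1) \<le> (\<Sum>j. cmod (cis (t j) - 1))" for N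
  proof -
    have "cis (\<Sum>j<N. t j) = (\<Prod>j<N. cis (t j))" by (induction N) (auto simp: cis_mult[symmetric])
    hence "cmod (cis (\<Sum>j<N. t j) - 1) \<le> (\<Sum>j<N. cmod (cis (t j) - 1))"
      using norm_prod_diff[of "{..<N}" "\<lambda>j. cis (t j)" "\<lambda>_. 1"] by simp
    also have "\<dots> \<le> (\<Sum>j. cmod (cis (t j) - 1))" by (intro sum_le_suminf b) auto
    finally show ?thesis .
  qed
  thus "\<exists>M. \<forall>N\<ge>M. cmod (cis (\<Sum>j<N. t j) - 1) \<le> (\<Sum>j. cmod (cis (t j) - 1))" by blast
qed

section \<open>The continuous measure\<close>

definition coin_tosses :: "(nat \<Rightarrow> real) \<Rightarrow> (nat \<Rightarrow> bool) measure" where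
  "coin_tosses p = (\<Pi>\<^sub>M j\<in>UNIV. measure_pmf (bernoulli_pmf (p j)))"

lemma sets_coin_tosses [measurable_cong]:
  "sets (coin_tosses p) = sets (\<Pi>\<^sub>M j\<in>UNIV. count_space UNIV)"
  by (auto simp: coin_tosses_def intro!: sets_PiM_cong)

lemma space_coin_tosses [simp]: "space (coin_tosses p) = UNIV"
  by (simp add: coin_tosses_def space_PiM PiE_UNIV_domain)

lemma prob_space_coin_tosses: "prob_space (coin_tosses p)"
  unfolding coin_tosses_def by (intro prob_space_PiM measure_pmf.prob_space_axioms)

lemma nn_integral_coin_toss:
  assumes "0 \<le> p j" "p j \<le> 1" "0 \<le> a"
  shows "(\<integral>\<^sup>+\<omega>. ennreal (of_bool (\<omega> j) * a) \<partial>coin_tosses p) = ennreal (p j * a)"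
proof -
  have "(\<integral>\<^sup>+\<omega>. ennreal (of_bool (\<omega> j) * a) \<partial>coin_tosses p) =
        (\<integral>\<^sup>+b. ennreal (of_bool b * a)
           \<partial>distr (coin_tosses p) (measure_pmf (bernoulli_pmf (p j))) (\<lambda>\<omega>. \<omega> j))"
    by (subst nn_integral_distr) (auto simp: coin_tosses_def)
  also have "distr (coin_tosses p) (measure_pmf (bernoulli_pmf (p j))) (\<lambda>\<omega>. \<omega> j) =
             measure_pmf (bernoulli_pmf (p j))"
    unfolding coin_tosses_def by (intro distr_PiM_component measure_pmf.prob_space_axioms) auto
  also have "(\<integral>\<^sup>+b. ennreal (of_bool b * a) \<partial>measure_pmf (bernoulli_pmf (p j))) = ennreal (p j * a)"
    using assms by (simp add: nn_integral_bernoulli_pmf ennreal_mult' mult.commute)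
  finally show ?thesis .
qed

text \<open>The point lies in the cylinder that fixes its first \<open>N\<close> coins. Each coin
  contributes a factor of at most \<open>exp (- p j)\<close>, and divergence of the series drives
  the product to 0.\<close>

lemma emeasure_coin_tosses_singleton:
  assumes p: "\<And>j. 0 \<le> p j" "\<And>j. p j \<le> 1/2" and ns: "\<not> summable p"
  shows "emeasure (coin_tosses p) {\<omega>} = 0"
proof -
  let ?q = "\<lambda>j. pmf (bernoulli_pmf (p j)) (\<omega> j)"
  have le: "emeasure (coin_tosses p) {\<omega>} \<le> ennreal (exp (- (\<Sum>j<N. p j)))" for N
  proof -
    let ?E = "prod_emb UNIV (\<lambda>j. measure_pmf (bernoulli_pmf (p j))) {..<N} (\<Pi>\<^sub>E j\<in>{..<N}. {\<omega> j})"
    have "emeasure (coin_tosses p) {\<omega>} \<le> emeasure (coin_tosses p) ?E"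
      unfolding coin_tosses_def
      by (intro emeasure_mono sets_PiM_I) (auto simp: prod_emb_def space_PiM)
    also have "\<dots> = (\<Prod>j<N. emeasure (measure_pmf (bernoulli_pmf (p j))) {\<omega> j})"
      unfolding coin_tosses_def
      by (intro emeasure_PiM_emb) (auto intro: measure_pmf.prob_space_axioms)
    also have "\<dots> = ennreal (\<Prod>j<N. ?q j)"
      by (simp add: emeasure_pmf_single prod_ennreal)
    also have "(\<Prod>j<N. ?q j) \<le> (\<Prod>j<N. exp (- p j))"
    proof (intro prod_mono conjI)
      fix j
      have p': "0 \<le> p j" "p j \<le> 1/2" by (rule p)+
      \<comment> \<open>As \<open>p j \<le> 1/2\<close>, the likelier outcome has probability
        \<open>1 - p j\<close>, so the bound covers both outcomes.\<close>
      have "?q j \<le> 1 - p j" using p' by (cases "\<omega> j") auto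
      also have "\<dots> \<le> exp (- p j)" using exp_ge_add_one_self[of "- p j"] by simp
      finally show "?q j \<le> exp (- p j)" .
    qed auto
    also have "(\<Prod>j<N. exp (- p j)) = exp (- (\<Sum>j<N. p j))"
      by (simp add: exp_sum sum_negf[symmetric])
    finally show ?thesis by (simp add: ennreal_leI)
  qed
  have unbounded: "\<not> (\<exists>B. \<forall>N. (\<Sum>j<N. p j) \<le> B)"
    using ns p(1) bounded_imp_summable[of p] by (metis lessThan_Suc_atMost)
  have small: "emeasure (coin_tosses p) {\<omega>} \<le> ennreal e" if "e > 0" for e :: real
  proof -
    obtain N where "(\<Sum>j<N. p j) > - ln e" using unbounded by (meson not_less)
    hence "exp (- (\<Sum>j<N. p j)) \<le> exp (ln e)" by (subst exp_le_cancel_iff) linarith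
    hence "ennreal (exp (- (\<Sum>j<N. p j))) \<le> ennreal e" using that by (intro ennreal_leI) simp
    with le[of N] show ?thesis by (rule order_trans)
  qed
  have "emeasure (coin_tosses p) {\<omega>} \<le> 0"
  proof (rule ennreal_le_epsilon)
    fix e :: real assume "0 < e"
    thus "emeasure (coin_tosses p) {\<omega>} \<le> 0 + ennreal e" unfolding add_0 by (rule small)
  qed
  thus ?thesis by simp
qed


section \<open>The image of the coin tosses on the circle\<close>

text \<open>By injectivity of the digit map each point of the circle pulls back to at most one toss
  sequence, which is null. For the Fourier bound, the pointwise estimate
  \<open>\<Sum>j. of_bool (\<omega> j) * a j\<close> is integrated term by term, coin
  \<open>j\<close> having mean \<open>p j\<close>.\<close>

lemma lacunary_circle_measure:
  assumes l: "lacunary \<theta>" and "\<theta> 0 < 1"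
    and p: "\<And>j. 0 \<le> p j" "\<And>j. p j \<le> 1/2" and ns: "\<not> summable p"
  obtains \<mu> where "circle_prob_measure \<mu>" "continuous_measure \<mu>"
    "\<And>m. cmod (fourier_coeff \<mu> m - 1) \<le> (\<Sum>j. p j * cmod (cis (\<theta> j) powi m - 1))"
proof -
  define T where "T \<omega> = (\<Sum>j. \<theta> j * of_bool (\<omega> j))" for \<omega> :: "nat \<Rightarrow> bool"
  define R where "R = restrict_space (borel :: complex measure) unit_circle"
  define \<mu> where "\<mu> = distr (coin_tosses p) R (\<lambda>\<omega>. cis (T \<omega>))"
  interpret P: prob_space "coin_tosses p" by (rule prob_space_coin_tosses)
  have T [measurable]: "T \<in> borel_measurable (coin_tosses p)"
    unfolding T_def by measurable
  have "(\<lambda>\<omega>. cis (T \<omega>)) \<in> borel_measurable (coin_tosses p)"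
    unfolding cis_conv_exp by measurable
  hence cisT [measurable]: "(\<lambda>\<omega>. cis (T \<omega>)) \<in> measurable (coin_tosses p) R"
    unfolding R_def by (intro measurable_restrict_space2) auto
  have "prob_space \<mu>" unfolding \<mu>_def by (rule P.prob_space_distr[OF cisT])
  hence "circle_prob_measure \<mu>"
    by (simp add: circle_prob_measure_def \<mu>_def R_def)
  moreover have "continuous_measure \<mu>"
    unfolding continuous_measure_def
  proof
    fix z assume z: "z \<in> unit_circle"
    have "{z} \<in> sets R" using z unfolding R_def by (auto simp: sets_restrict_space_iff)
    hence em: "emeasure \<mu> {z} = emeasure (coin_tosses p) ((\<lambda>\<omega>. cis (T \<omega>)) -` {z})"
      unfolding \<mu>_def by (subst emeasure_distr[OF cisT]) auto
    have inj: "inj (\<lambda>\<omega>. cis (T \<omega>))"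
      unfolding T_def using assms by (intro inj_lacunary_cis)
    show "emeasure \<mu> {z} = 0"
    proof (cases "z \<in> range (\<lambda>\<omega>. cis (T \<omega>))")
      case True
      then obtain \<omega> where "z = cis (T \<omega>)" by blast
      hence "(\<lambda>\<omega>. cis (T \<omega>)) -` {z} = {\<omega>}" using injD[OF inj] by blast
      thus ?thesis using em emeasure_coin_tosses_singleton[OF p ns] by simp
    next
      case False
      hence "(\<lambda>\<omega>. cis (T \<omega>)) -` {z} = {}" by blast
      thus ?thesis using em by simp
    qed
  qed
  moreover have "cmod (fourier_coeff \<mu> m - 1) \<le> (\<Sum>j. p j * cmod (cis (\<theta> j) powi m - 1))" for m
  proof -
    define a where "a j = cmod (cis (\<theta> j) powi m - 1)" for j
    have a: "0 \<le> a j" for j by (simp add: a_def)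
    \<comment> \<open>For a fixed exponent the distances are summable because the angles are; this
      needs nothing about the weights, whose series diverges.\<close>
    have "a j \<le> \<bar>real_of_int m\<bar> * \<theta> j" for j
      using cmod_cis_minus_1_le[of "real_of_int m * \<theta> j"] l
      by (simp add: a_def cis_power_int lacunary_def abs_mult abs_of_pos)
    hence sa: "summable a"
      by (intro summable_comparison_test'[OF summable_mult[OF summable_lacunary[OF l]], of 0]) (simp add: a)
    have sb: "summable (\<lambda>j. of_bool (\<omega> j) * a j)" for \<omega>
      by (intro summable_comparison_test'[OF sa, of 0]) (auto simp: a)
    have spa: "summable (\<lambda>j. p j * a j)"
    proof (intro summable_comparison_test'[OF sa, of 0])
      show "norm (p j * a j) \<le> a j" for j
        using p[of j] a[of j] by (simp add: mult_left_le_one_le)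
    qed
    have powi: "cis (T \<omega>) powi m = cis (real_of_int m * T \<omega>)" for \<omega>
      by (rule cis_power_int)
    have bound: "cmod (cis (T \<omega>) powi m - 1) \<le> (\<Sum>j. of_bool (\<omega> j) * a j)" for \<omega>
    proof -
      have sT: "summable (\<lambda>j. \<theta> j * of_bool (\<omega> j))" by (intro summable_lacunary_digits[OF l]) simp
      \<comment> \<open>A digit 0 gives the factor \<open>cis 0 = 1\<close> and adds no
        distance.\<close>
      have digit: "cmod (cis (real_of_int m * (\<theta> j * of_bool (\<omega> j))) - 1) = of_bool (\<omega> j) * a j" for j
        by (simp add: a_def cis_power_int of_bool_def)
      have "real_of_int m * T \<omega> = (\<Sum>j. real_of_int m * (\<theta> j * of_bool (\<omega> j)))"
        unfolding T_def by (rule suminf_mult[OF sT, symmetric])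
      thus ?thesis
        using cmod_cis_suminf_minus_1_le[OF summable_mult[OF sT, of "real_of_int m"]] sb[of \<omega>]
        unfolding digit powi by simp
    qed
    have meas [measurable]: "(\<lambda>\<omega>. cis (T \<omega>) powi m) \<in> borel_measurable (coin_tosses p)"
      unfolding powi unfolding cis_conv_exp by measurable
    have int: "integrable (coin_tosses p) (\<lambda>\<omega>. cis (T \<omega>) powi m)"
      by (rule P.integrable_const_bound[of _ 1]) (use meas in \<open>auto simp: powi\<close>)
    have "(\<lambda>z. z powi m) \<in> borel_measurable R"
      unfolding R_def by (intro borel_measurable_continuous_on_restrict continuous_intros) auto
    hence "fourier_coeff \<mu> m = (\<integral>\<omega>. cis (T \<omega>) powi m \<partial>coin_tosses p)"
      unfolding fourier_coeff_def \<mu>_def by (rule integral_distr[OF cisT])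
    hence "fourier_coeff \<mu> m - 1 = (\<integral>\<omega>. (cis (T \<omega>) powi m - 1) \<partial>coin_tosses p)"
      using int P.prob_space by simp
    moreover have "integrable (coin_tosses p) (\<lambda>\<omega>. cis (T \<omega>) powi m - 1)"
      using int by simp
    \<comment> \<open>From here on the integrals are of nonnegative functions in
      \<open>ennreal\<close>, so sum and integral can be exchanged without an integrability
      argument.\<close>
    ultimately have "ennreal (cmod (fourier_coeff \<mu> m - 1)) \<le>
           (\<integral>\<^sup>+\<omega>. ennreal (cmod (cis (T \<omega>) powi m - 1)) \<partial>coin_tosses p)"
      by (simp only: integral_norm_bound_ennreal)
    also have "\<dots> \<le> (\<integral>\<^sup>+\<omega>. (\<Sum>j. ennreal (of_bool (\<omega> j) * a j)) \<partial>coin_tosses p)"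
      using bound sb a by (intro nn_integral_mono) (subst suminf_ennreal2, auto intro: ennreal_leI)
    also have "\<dots> = (\<Sum>j. \<integral>\<^sup>+\<omega>. ennreal (of_bool (\<omega> j) * a j) \<partial>coin_tosses p)"
      by (rule nn_integral_suminf) measurable
    also have "\<dots> = (\<Sum>j. ennreal (p j * a j))"
    proof (intro suminf_cong nn_integral_coin_toss a p)
      show "p j \<le> 1" for j using p(2)[of j] by simp
    qed
    also have "\<dots> = ennreal (\<Sum>j. p j * a j)"
      using spa p a by (intro suminf_ennreal2) auto
    finally have "cmod (fourier_coeff \<mu> m - 1) \<le> (\<Sum>j. p j * a j)"
      using suminf_nonneg[OF spa] p a by (subst (asm) ennreal_le_iff) auto
    thus ?thesis by (simp add: a_def)
  qed
  ultimately show ?thesis using that by blast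
qed

section \<open>Weighted sums with one exceptional index\<close>

text \<open>All weights in the tail are at most \<open>p M\<close>. The geometric terms sum to 2 and
  the exceptional index adds at most 2, whence the factor 4, whatever \<open>j\<close> is.\<close>

lemma weighted_tail_le:
  fixes a p :: "nat \<Rightarrow> real"
  assumes p: "\<And>i. 0 \<le> p i" "antimono p"
    and a: "\<And>i. 0 \<le> a i" "\<And>i. a i \<le> 2" "\<And>i. i \<noteq> j \<Longrightarrow> a i \<le> (1/2) ^ i"
  shows "summable (\<lambda>i. p i * a i)" and "(\<Sum>i. p (i + M) * a (i + M)) \<le> 4 * p M"
proof -
  let ?b = "\<lambda>M i. p M * ((1/2) ^ i + (if i + M = j then 2 else 0))"
  have le: "p (i + M) * a (i + M) \<le> ?b M i" for M i
  proof (intro mult_mono a p(1) antimonoD[OF p(2)])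
    have "a (i + M) \<le> (1/2) ^ (i + M)" if "i + M \<noteq> j" using a(3)[OF that] .
    also have "(1/2 :: real) ^ (i + M) \<le> (1/2) ^ i" by (intro power_decreasing) auto
    finally show "a (i + M) \<le> (1/2) ^ i + (if i + M = j then 2 else 0)"
      using a(2)[of j] by (auto intro: add_increasing)
  qed simp
  have b: "summable (?b M)" "suminf (?b M) \<le> 4 * p M" for M
  proof -
    \<comment> \<open>If \<open>j < M\<close> the exceptional index is not in the tail, while the
      truncated difference \<open>j - M\<close> is 0; the guard \<open>M \<le> j\<close> then
      removes the value 2.\<close>
    have "(\<lambda>i. if i = j - M then (if M \<le> j then 2 else 0) else 0 :: real) sums (if M \<le> j then 2 else 0)"
      by (rule sums_single)
    moreover have "(if i = j - M then (if M \<le> j then 2 else 0) else 0) = (if i + M = j then 2 else 0 :: real)" for i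
      by auto
    ultimately have "(\<lambda>i. if i + M = j then 2 else 0 :: real) sums (if M \<le> j then 2 else 0)" by simp
    with geometric_sums[of "1/2 :: real"]
    have "?b M sums (p M * (2 + (if M \<le> j then 2 else 0)))"
      by (intro sums_mult sums_add) auto
    thus "summable (?b M)" "suminf (?b M) \<le> 4 * p M"
      using p(1)[of M] by (auto simp: sums_iff)
  qed
  have sM: "summable (\<lambda>i. p (i + M) * a (i + M))" for M
    using le[of _ M] p a by (intro summable_comparison_test'[OF b(1)[of M], of 0]) simp
  show "summable (\<lambda>i. p i * a i)" using sM[of 0] by simp
  show "(\<Sum>i. p (i + M) * a (i + M)) \<le> 4 * p M"
    using suminf_le[OF le sM b(1), of M] b(2)[of M] by linarith
qed

text \<open>The exceptional index varies with \<open>k\<close>, and the majorant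
  \<open>2 * p i\<close> may have infinite sum. Instead the sum is cut at a fixed \<open>M\<close>:
  the tail is at most \<open>4 * p M\<close> uniformly in \<open>k\<close>, and the head is a finite
  sum of null sequences.\<close>

lemma weighted_sums_tendsto_0:
  fixes a :: "nat \<Rightarrow> nat \<Rightarrow> real" and p :: "nat \<Rightarrow> real"
  assumes p: "\<And>i. 0 \<le> p i" "antimono p" "p \<longlonglongrightarrow> 0"
    and a: "\<And>i k. 0 \<le> a i k" "\<And>i k. a i k \<le> 2" "\<And>k. \<exists>j. \<forall>i. i \<noteq> j \<longrightarrow> a i k \<le> (1/2) ^ i"
    and lim: "\<And>i. a i \<longlonglongrightarrow> 0"
  shows "(\<lambda>k. \<Sum>i. p i * a i k) \<longlonglongrightarrow> 0"
proof (rule LIMSEQ_I)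
  fix r :: real assume "r > 0"
  \<comment> \<open>With \<open>r / 8\<close> the tail bound \<open>4 * p M\<close> stays below
    \<open>r / 2\<close>, leaving \<open>r / 2\<close> for the head.\<close>
  then obtain M where M: "p M < r / 8"
    using LIMSEQ_D[OF p(3), of "r / 8"] p(1) by auto
  have "(\<lambda>k. \<Sum>i<M. p i * a i k) \<longlonglongrightarrow> 0"
    by (intro tendsto_null_sum tendsto_mult_right_zero lim)
  then obtain K where K: "\<And>k. k \<ge> K \<Longrightarrow> (\<Sum>i<M. p i * a i k) < r / 2"
    using LIMSEQ_D[of _ 0 "r / 2"] \<open>r > 0\<close> by fastforce
  have "norm ((\<Sum>i. p i * a i k) - 0) < r" if "k \<ge> K" for k
  proof -
    obtain j where j: "\<And>i. i \<noteq> j \<Longrightarrow> a i k \<le> (1/2) ^ i" using a(3) by blast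
    note w = weighted_tail_le[of p "\<lambda>i. a i k" j, OF p(1,2) a(1,2) j]
    have "(\<Sum>i. p i * a i k) < r"
      using suminf_split_initial_segment[OF w(1), of M] w(2)[of M] K[OF that] M by simp
    thus ?thesis using suminf_nonneg[OF w(1)] p(1) a(1) by simp
  qed
  thus "\<exists>no. \<forall>k\<ge>no. norm ((\<Sum>i. p i * a i k) - 0) < r" by blast
qed

lemma exists_continuous_measure_fourier_near_1:
  fixes n :: "nat \<Rightarrow> int"
  assumes l: "lacunary \<theta>" and \<theta>0: "\<theta> 0 < 1"
    and lim: "\<And>j. (\<lambda>k. cis (\<theta> j) powi n k) \<longlonglongrightarrow> 1"
    and near: "\<And>k. \<exists>j. \<forall>i. i \<noteq> j \<longrightarrow> cmod (cis (\<theta> i) powi n k - 1) \<le> (1/2) ^ i"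
    and "\<epsilon> > 0"
  shows "\<exists>\<mu>. circle_prob_measure \<mu> \<and> continuous_measure \<mu> \<and>
            (\<lambda>k. fourier_coeff \<mu> (n k)) \<longlonglongrightarrow> 1 \<and>
            (SUP k. cmod (fourier_coeff \<mu> (n k) - 1)) < \<epsilon>"
proof -
  \<comment> \<open>The bound 1/2 keeps all \<open>p j \<le> 1/2\<close>; the bound
    \<open>\<epsilon> / 8\<close> gives \<open>4 * p 0 = 4 * c \<le> \<epsilon> / 2\<close>, so that
    the supremum stays strictly below \<open>\<epsilon>\<close>.\<close>
  define c where "c = min (\<epsilon> / 8) (1/2)"
  have c: "0 < c" "c \<le> \<epsilon> / 8" "c \<le> 1/2" using \<open>\<epsilon> > 0\<close> by (auto simp: c_def)
  \<comment> \<open>Harmonic weights meet two competing demands: a divergent sum, which excludes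
    atoms, and limit 0, which makes the exceptional index harmless as it moves out.\<close>
  define p where "p j = c * inverse (real (Suc j))" for j
  have p: "0 \<le> p j" "p j \<le> 1/2" for j
  proof -
    have "p j \<le> c * 1"
      unfolding p_def using c by (intro mult_left_mono) (auto simp: field_simps)
    thus "p j \<le> 1/2" using c by linarith
    show "0 \<le> p j" using c by (simp add: p_def)
  qed
  have anti: "antimono p"
    unfolding p_def using c by (intro antimonoI mult_left_mono le_imp_inverse_le) auto
  have p0: "p \<longlonglongrightarrow> 0"
    unfolding p_def by (intro tendsto_mult_right_zero LIMSEQ_inverse_real_of_nat)
  have ns: "\<not> summable p"
  proof
    assume "summable p"
    hence "summable (\<lambda>j. inverse c * p j)" by (rule summable_mult)
    hence "summable (\<lambda>j. inverse (real (Suc j)))"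
      using c by (simp add: p_def mult.assoc[symmetric] del: of_nat_Suc)
    hence "summable (\<lambda>j. inverse (real j))"
      using summable_Suc_iff[of "\<lambda>j. inverse (real j)"] by blast
    thus False using not_summable_harmonic[where 'a = real] by blast
  qed
  from lacunary_circle_measure[OF l \<theta>0 p ns] obtain \<mu> where \<mu>:
    "circle_prob_measure \<mu>" "continuous_measure \<mu>"
    "\<And>m. cmod (fourier_coeff \<mu> m - 1) \<le> (\<Sum>j. p j * cmod (cis (\<theta> j) powi m - 1))" by blast
  let ?a = "\<lambda>i k. cmod (cis (\<theta> i) powi n k - 1)"
  have a2: "?a i k \<le> 2" for i k
    unfolding cis_power_int by (rule cmod_cis_minus_1_le_2)
  have "?a i \<longlonglongrightarrow> 0" for i
    using tendsto_norm_zero[OF LIM_zero[OF lim[of i]]] .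
  hence "(\<lambda>k. \<Sum>i. p i * ?a i k) \<longlonglongrightarrow> 0"
    using weighted_sums_tendsto_0[of p ?a] p anti p0 a2 near by simp
  hence "(\<lambda>k. fourier_coeff \<mu> (n k) - 1) \<longlonglongrightarrow> 0"
    by (rule Lim_null_comparison[rotated]) (simp add: \<mu>(3))
  hence L: "(\<lambda>k. fourier_coeff \<mu> (n k)) \<longlonglongrightarrow> 1" by (rule LIM_zero_cancel)
  have "cmod (fourier_coeff \<mu> (n k) - 1) \<le> \<epsilon> / 2" for k
  proof -
    obtain j where j: "\<And>i. i \<noteq> j \<Longrightarrow> ?a i k \<le> (1/2) ^ i" using near by blast
    have "(\<Sum>i. p (i + 0) * ?a (i + 0) k) \<le> 4 * p 0"
      by (rule weighted_tail_le[OF p(1) anti _ a2 j]) auto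
    also have "\<dots> \<le> \<epsilon> / 2" using c by (simp add: p_def)
    finally show ?thesis using \<mu>(3)[of "n k"] by simp
  qed
  hence "(SUP k. cmod (fourier_coeff \<mu> (n k) - 1)) \<le> \<epsilon> / 2"
    by (intro cSUP_least) auto
  with \<mu> L \<open>\<epsilon> > 0\<close> show ?thesis by (intro exI[of _ \<mu>]) auto
qed

section \<open>A finite-dimensional obstruction to the Kazhdan property\<close>

text \<open>Vectors are sequences, the vector type over which \<open>kazhdan_subset\<close>
  quantifies. Requiring them to vanish from index \<open>N\<close> on makes the form
  definite.\<close>

definition coord_space :: "nat \<Rightarrow> (nat \<Rightarrow> complex) inner_product_module" where
  "coord_space N = \<lparr>carrier = {x. \<forall>i\<ge>N. x i = 0}, monoid.mult = (\<lambda>x y i. 0), one = (\<lambda>i. 0),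
     ring.zero = (\<lambda>i. 0), add = (\<lambda>x y i. x i + y i), module.smult = (\<lambda>a x i. a * x i),
     cinner = (\<lambda>x y. \<Sum>i<N. x i * cnj (y i))\<rparr>"

lemma coord_space_simps [simp]:
  "carrier (coord_space N) = {x. \<forall>i\<ge>N. x i = 0}"
  "ring.zero (coord_space N) = (\<lambda>i. 0)"
  "add (coord_space N) x y = (\<lambda>i. x i + y i)"
  "module.smult (coord_space N) a x = (\<lambda>i. a * x i)"
  "cinner (coord_space N) x y = (\<Sum>i<N. x i * cnj (y i))"
  by (simp_all add: coord_space_def)

lemma abelian_group_coord_space: "abelian_group (coord_space N)"
proof (rule abelian_groupI)
  fix x assume "x \<in> carrier (coord_space N)"
  thus "\<exists>y\<in>carrier (coord_space N). y \<oplus>\<^bsub>coord_space N\<^esub> x = \<zero>\<^bsub>coord_space N\<^esub>"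
    by (intro bexI[of _ "\<lambda>i. - x i"]) auto
qed (auto simp: algebra_simps)

lemma coord_space_minus:
  assumes "x \<in> carrier (coord_space N)" "y \<in> carrier (coord_space N)"
  shows "x \<ominus>\<^bsub>coord_space N\<^esub> y = (\<lambda>i. x i - y i)"
proof -
  interpret abelian_group "coord_space N" by (rule abelian_group_coord_space)
  have "\<ominus>\<^bsub>coord_space N\<^esub> y = (\<lambda>i. - y i)"
    using assms by (intro minus_equality) auto
  thus ?thesis by (simp add: a_minus_def)
qed

lemma cnorm_coord_space: "cnorm (coord_space N) x = L2_set (\<lambda>i. cmod (x i)) {..<N}"
  by (simp add: cnorm_def L2_set_def complex_norm_square[symmetric] flip: of_real_sum of_real_power)

lemma cdist_coord_space:
  assumes "x \<in> carrier (coord_space N)" "y \<in> carrier (coord_space N)"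
  shows "cdist (coord_space N) x y = L2_set (\<lambda>i. cmod (x i - y i)) {..<N}"
  using assms unfolding cdist_def by (simp add: coord_space_minus cnorm_coord_space)

lemma complex_inner_product_space_coord_space: "complex_inner_product_space (coord_space N)"
proof -
  have "Module.module (ring_of_type_algebra :: complex ring) (coord_space N)"
    by (rule moduleI[OF cring_from_type_algebra abelian_group_coord_space])
       (auto simp: ring_of_type_algebra_def algebra_simps)
  moreover have "complex_inner_product_space_axioms (coord_space N)"
  proof
    fix x assume x: "x \<in> carrier (coord_space N)" "cinner (coord_space N) x x = 0"
    hence "cnorm (coord_space N) x = 0" by (simp add: cnorm_def)
    hence "\<forall>i<N. x i = 0" by (simp add: cnorm_coord_space L2_set_eq_0_iff)
    with x show "x = \<zero>\<^bsub>coord_space N\<^esub>" by (auto simp: fun_eq_iff) (metis not_less)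
  next
    fix x show "Re (cinner (coord_space N) x x) \<ge> 0"
      by (simp add: sum_nonneg)
  qed (auto simp: sum.distrib sum_distrib_left algebra_simps)
  ultimately show ?thesis by (rule complex_inner_product_space.intro)
qed

lemma Metric_space_coord_space:
  "Metric_space (carrier (coord_space N)) (cdist (coord_space N))" (is "Metric_space ?C ?d")
proof
  show "0 \<le> ?d x y" for x y
    by (cases "x \<in> ?C \<and> y \<in> ?C") (auto simp: cdist_coord_space, auto simp: cdist_def)
  show "?d x y = ?d y x" for x y
  proof (cases "x \<in> ?C \<and> y \<in> ?C")
    case True
    thus ?thesis using cdist_coord_space[of x N y] cdist_coord_space[of y N x]
      by (simp add: norm_minus_commute)
  qed (auto simp: cdist_def)
  show "?d x y = 0 \<longleftrightarrow> x = y" if xy: "x \<in> ?C" "y \<in> ?C" for x y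
  proof -
    have "?d x y = 0 \<longleftrightarrow> (\<forall>i<N. x i = y i)"
      by (simp add: cdist_coord_space[OF xy] L2_set_eq_0_iff Ball_def)
    also have "\<dots> \<longleftrightarrow> x = y" using xy by (auto simp: fun_eq_iff) (metis not_less)
    finally show ?thesis .
  qed
  show "?d x z \<le> ?d x y + ?d y z" if xyz: "x \<in> ?C" "y \<in> ?C" "z \<in> ?C" for x y z
  proof -
    have "?d x z \<le> L2_set (\<lambda>i. cmod (x i - y i) + cmod (y i - z i)) {..<N}"
      unfolding cdist_coord_space[OF xyz(1,3)]
      by (intro L2_set_mono) (auto intro: norm_triangle_le_diff order_trans[OF _ norm_triangle_ineq])
    also have "\<dots> \<le> ?d x y + ?d y z"
      unfolding cdist_coord_space[OF xyz(1,2)] cdist_coord_space[OF xyz(2,3)]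
      by (rule L2_set_triangle_ineq)
    finally show ?thesis .
  qed
qed

lemma separable_complex_hilbert_space_coord_space:
  "separable_complex_hilbert_space (coord_space N)"
proof -
  let ?C = "carrier (coord_space N)"
  interpret complex_inner_product_space "coord_space N"
    by (rule complex_inner_product_space_coord_space)
  interpret Metric_space ?C "cdist (coord_space N)"
    by (rule Metric_space_coord_space)
  have mcomplete: mcomplete
    unfolding mcomplete_def
  proof (intro allI impI)
    fix s assume s: "MCauchy s"
    hence sC: "s m \<in> ?C" for m unfolding MCauchy_def by blast
    have "Cauchy (\<lambda>m. s m i)" if "i < N" for i
    proof (rule metric_CauchyI)
      fix e :: real assume "e > 0"
      then obtain M where M: "\<And>m m'. M \<le> m \<Longrightarrow> M \<le> m' \<Longrightarrow> cdist (coord_space N) (s m) (s m') < e"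
        using s unfolding MCauchy_def by meson
      have "dist (s m i) (s m' i) < e" if "M \<le> m" "M \<le> m'" for m m'
      proof -
        have "dist (s m i) (s m' i) \<le> cdist (coord_space N) (s m) (s m')"
          using member_le_L2_set[of "{..<N}" i "\<lambda>i. cmod (s m i - s m' i)"] \<open>i < N\<close>
          by (simp add: cdist_coord_space[OF sC sC] dist_norm)
        with M[OF that] show ?thesis by simp
      qed
      thus "\<exists>M. \<forall>m\<ge>M. \<forall>n\<ge>M. dist (s m i) (s n i) < e" by blast
    qed
    hence "\<forall>i. \<exists>l. i < N \<longrightarrow> (\<lambda>m. s m i) \<longlonglongrightarrow> l"
      by (metis Cauchy_convergent_iff convergent_def)
    then obtain l where l: "\<And>i. i < N \<Longrightarrow> (\<lambda>m. s m i) \<longlonglongrightarrow> l i" by metis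
    define x where "x i = (if i < N then l i else 0)" for i
    have x: "x \<in> ?C" by (simp add: x_def)
    \<comment> \<open>Coordinatewise limits suffice because the norm is a continuous function of
      finitely many coordinates; the limit written on the right is 0.\<close>
    have "(\<lambda>m. L2_set (\<lambda>i. cmod (s m i - x i)) {..<N}) \<longlonglongrightarrow> sqrt (\<Sum>i<N. (cmod (x i - x i))\<^sup>2)"
      unfolding L2_set_def using l by (intro tendsto_intros) (auto simp: x_def)
    hence "(\<lambda>m. cdist (coord_space N) (s m) x) \<longlonglongrightarrow> 0"
      by (simp add: cdist_coord_space[OF sC x])
    thus "\<exists>x. limitin mtopology s x sequentially"
      using x sC unfolding limitin_metric_dist_null by (intro exI[of _ x]) auto
  qed
  have separable: "separable_space mtopology"
  proof -
    obtain D :: "complex set" where D: "countable D" "\<And>A. open A \<Longrightarrow> A \<noteq> {} \<Longrightarrow> \<exists>d\<in>D. d \<in> A"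
      using countable_dense_exists by blast
    define E where "E = (\<lambda>f i. if i < N then f i else 0) ` ({..<N} \<rightarrow>\<^sub>E D)"
    have "countable E"
      \<comment> \<open>Countability holds because only \<open>N\<close> coordinates are free.
        Elements of the extensional product are \<open>undefined\<close> from \<open>N\<close> on;
        resetting these entries to 0 puts them in the carrier.\<close>
      unfolding E_def using D(1) by (intro countable_image countable_PiE) auto
    moreover have "E \<subseteq> ?C" by (force simp: E_def)
    ultimately have E: "countable E" "E \<subseteq> ?C" by blast+
    have dense: "\<exists>y\<in>E. y \<in> mball x r" if x: "x \<in> ?C" and r: "r > 0" for x r
    proof -
      \<comment> \<open>The \<open>N\<close> coordinate errors add up to at most
        \<open>N * e\<close>; the denominator \<open>N + 1\<close> keeps this strictly below
        \<open>r\<close> and is nonzero also for \<open>N = 0\<close>.\<close>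
      define e where "e = r / (real N + 1)"
      have "e > 0" using r by (simp add: e_def)
      hence "\<forall>i. \<exists>d\<in>D. d \<in> ball (x i) e" by (intro allI D(2)) auto
      then obtain d where d: "\<And>i. d i \<in> D" "\<And>i. dist (x i) (d i) < e" by (auto simp: Bex_def) metis
      define y where "y i = (if i < N then d i else 0)" for i
      have "y = (\<lambda>i. if i < N then restrict d {..<N} i else 0)" by (auto simp: y_def)
      hence y: "y \<in> E" unfolding E_def using d(1) by (intro image_eqI[of _ _ "restrict d {..<N}"]) auto
      have "cdist (coord_space N) x y \<le> (\<Sum>i<N. cmod (x i - y i))"
        using x y E(2) by (subst cdist_coord_space) (auto intro: L2_set_le_sum)
      also have "\<dots> \<le> (\<Sum>i<N. e)"
        using d(2) by (intro sum_mono) (auto simp: y_def dist_norm less_imp_le)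
      also have "\<dots> < r" using r by (simp add: e_def field_simps)
      finally have "cdist (coord_space N) x y < r" .
      moreover have "y \<in> ?C" using y E(2) by blast
      ultimately show ?thesis using x y unfolding in_mball by blast
    qed
    have "mtopology closure_of E = topspace mtopology"
      unfolding metric_closure_of topspace_mtopology using dense by blast
    thus ?thesis
      unfolding separable_space_def topspace_mtopology using E by blast
  qed
  show ?thesis
    by unfold_locales (use mcomplete separable in auto)
qed

section \<open>Diagonal unitaries and their integer powers\<close>

definition diagonal_operator :: "(nat \<Rightarrow> complex) \<Rightarrow> (nat \<Rightarrow> complex) \<Rightarrow> nat \<Rightarrow> complex" where
  "diagonal_operator z x = (\<lambda>i. z i * x i)"

lemma funpow_diagonal_operator:
  "(diagonal_operator z ^^ m) x = diagonal_operator (\<lambda>i. z i ^ m) x"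
  by (induction m) (auto simp: diagonal_operator_def)

lemma diagonal_operator_in_carrier:
  "x \<in> carrier (coord_space N) \<Longrightarrow> diagonal_operator z x \<in> carrier (coord_space N)"
  by (simp add: diagonal_operator_def)

lemma bij_betw_diagonal_operator:
  assumes "\<And>i. z i \<noteq> 0"
  shows "bij_betw (diagonal_operator z) (carrier (coord_space N)) (carrier (coord_space N))"
  by (rule bij_betw_byWitness[of _ "diagonal_operator (\<lambda>i. inverse (z i))"])
     (use assms in \<open>auto simp: diagonal_operator_def\<close>)

lemma unitary_diagonal_operator:
  assumes z: "\<And>i. cmod (z i) = 1"
  shows "unitary_operator (coord_space N) (diagonal_operator z)"
proof -
  have z0: "z i \<noteq> 0" for i using z[of i] by auto
  have "z i * cnj (z i) = 1" for i using z[of i] by (simp add: complex_norm_square[symmetric])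
  hence "z i * a * cnj (z i * b) = a * cnj b" for i a b
    by (metis complex_cnj_mult mult.assoc mult.commute mult_1)
  hence "(\<Sum>i<N. z i * x i * cnj (z i * y i)) = (\<Sum>i<N. x i * cnj (y i))" for x y
    by (intro sum.cong refl) blast
  thus ?thesis
    unfolding unitary_operator_def using bij_betw_diagonal_operator[of z N, OF z0]
    by (simp add: diagonal_operator_def distrib_left mult.left_commute del: complex_cnj_mult)
qed

lemma operator_powi_diagonal:
  assumes z: "\<And>i. z i \<noteq> 0" and x: "x \<in> carrier (coord_space N)"
  shows "operator_powi (coord_space N) (diagonal_operator z) m x = diagonal_operator (\<lambda>i. z i powi m) x"
proof (cases "m \<ge> 0")
  case True
  thus ?thesis by (simp add: operator_powi_def funpow_diagonal_operator power_int_def)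
next
  case False
  let ?C = "carrier (coord_space N)" and ?U' = "diagonal_operator (\<lambda>i. inverse (z i))"
  have inv: "inv_into ?C (diagonal_operator z) y = ?U' y" if "y \<in> ?C" for y
  proof (rule inv_into_f_eq)
    show "inj_on (diagonal_operator z) ?C"
      using bij_betw_diagonal_operator[of z N, OF z] by (rule bij_betw_imp_inj_on)
    show "?U' y \<in> ?C" using that by (rule diagonal_operator_in_carrier)
    show "diagonal_operator z (?U' y) = y" by (simp add: diagonal_operator_def z fun_eq_iff mult.assoc[symmetric])
  qed
  \<comment> \<open>The inverse is identified on the carrier only, so the induction carries along
    that the iterates stay there.\<close>
  have "(inv_into ?C (diagonal_operator z) ^^ j) x = (?U' ^^ j) x \<and> (?U' ^^ j) x \<in> ?C" for j
  proof (induction j)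
    case (Suc j)
    thus ?case using inv diagonal_operator_in_carrier unfolding funpow.simps o_apply by metis
  qed (use x in simp)
  thus ?thesis using False
    by (simp add: operator_powi_def funpow_diagonal_operator power_int_def)
qed

section \<open>Failure of the Kazhdan property\<close>

text \<open>For the unit vector with \<open>N\<close> equal coordinates, the squared displacement
  under the power \<open>m\<close> of the diagonal unitary is the average of the squared distances
  of \<open>z i powi m\<close> from 1. A fixed vector must vanish wherever
  \<open>z i \<noteq> 1\<close>.\<close>

lemma not_kazhdan_subsetI:
  assumes "\<And>\<epsilon>. \<epsilon> > 0 \<Longrightarrow> \<exists>N z. N > 0 \<and> (\<forall>i. cmod (z i) = 1 \<and> z i \<noteq> 1) \<and>
             (\<forall>m\<in>Q. (\<Sum>i<N. (cmod (z i powi m - 1))\<^sup>2) \<le> real N * \<epsilon>\<^sup>2)"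
  shows "\<not> kazhdan_subset Q"
proof
  assume "kazhdan_subset Q"
  then obtain \<epsilon> where "\<epsilon> > 0" and kazhdan: "\<And>V :: (nat \<Rightarrow> complex) inner_product_module.
      separable_complex_hilbert_space V \<Longrightarrow> kazhdan_property V Q \<epsilon>"
    unfolding kazhdan_subset_def by blast
  \<comment> \<open>Half of \<open>\<epsilon>\<close> is used because a supremum of values at most
    \<open>\<epsilon> / 2\<close> is still strictly below \<open>\<epsilon>\<close>.\<close>
  obtain N z where N: "N > 0" and z: "\<And>i. cmod (z i) = 1" "\<And>i. z i \<noteq> 1"
    and Q: "\<And>m. m \<in> Q \<Longrightarrow> (\<Sum>i<N. (cmod (z i powi m - 1))\<^sup>2) \<le> real N * (\<epsilon> / 2)\<^sup>2"
    using assms[of "\<epsilon> / 2"] \<open>\<epsilon> > 0\<close> by auto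
  have z0: "z i \<noteq> 0" for i using z(1)[of i] by auto
  let ?V = "coord_space N" and ?U = "diagonal_operator z"
  define x :: "nat \<Rightarrow> complex" where "x i = (if i < N then of_real (1 / sqrt (real N)) else 0)" for i
  have x: "x \<in> carrier ?V" by (simp add: x_def)
  have norm_x: "cnorm ?V x = 1"
    using N by (simp add: cnorm_coord_space x_def L2_set_def power_divide norm_divide)
  have "cnorm ?V (operator_powi ?V ?U m x \<ominus>\<^bsub>?V\<^esub> x) \<le> \<epsilon> / 2" if "m \<in> Q" for m
  proof -
    have "operator_powi ?V ?U m x \<ominus>\<^bsub>?V\<^esub> x = (\<lambda>i. (z i powi m - 1) * x i)"
      using x diagonal_operator_in_carrier[OF x]
      by (subst operator_powi_diagonal[OF z0 x], subst coord_space_minus)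
         (auto simp: diagonal_operator_def algebra_simps)
    hence "cnorm ?V (operator_powi ?V ?U m x \<ominus>\<^bsub>?V\<^esub> x) =
             sqrt (\<Sum>i<N. (cmod (z i powi m - 1))\<^sup>2 / real N)"
      using N by (simp add: cnorm_coord_space L2_set_def x_def norm_mult norm_divide
                    power_mult_distrib power_divide)
    also have "\<dots> = sqrt ((\<Sum>i<N. (cmod (z i powi m - 1))\<^sup>2) / real N)"
      by (simp add: sum_divide_distrib)
    also have "\<dots> \<le> sqrt ((\<epsilon> / 2)\<^sup>2)"
      using Q[OF that] N by (intro real_sqrt_le_mono) (simp add: divide_le_eq mult.commute)
    finally show ?thesis using \<open>\<epsilon> > 0\<close> by simp
  qed
  hence "(SUP m\<in>Q. ennreal (cnorm ?V (operator_powi ?V ?U m x \<ominus>\<^bsub>?V\<^esub> x))) \<le> ennreal (\<epsilon> / 2)"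
    by (intro SUP_least ennreal_leI)
  also have "\<dots> < ennreal \<epsilon>" using \<open>\<epsilon> > 0\<close> by (intro ennreal_lessI) auto
  finally have "(SUP m\<in>Q. ennreal (cnorm ?V (operator_powi ?V ?U m x \<ominus>\<^bsub>?V\<^esub> x))) < ennreal \<epsilon>" .
  with norm_x obtain y where y: "y \<noteq> \<zero>\<^bsub>?V\<^esub>" "?U y = y"
    using kazhdan[OF separable_complex_hilbert_space_coord_space] unitary_diagonal_operator[of z N, OF z(1)] x
    unfolding kazhdan_property_def by blast
  have "y i = 0" for i
    using fun_cong[OF y(2), of i] z(2)[of i] by (simp add: diagonal_operator_def)
  with y(1) show False by auto
qed

lemma lacunary_angles_not_kazhdan:
  fixes n :: "nat \<Rightarrow> int"
  assumes l: "lacunary \<theta>" and \<theta>0: "\<theta> 0 < 1"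
    and near: "\<And>k. \<exists>j. \<forall>i. i \<noteq> j \<longrightarrow> cmod (cis (\<theta> i) powi n k - 1) \<le> (1/2) ^ i"
  shows "\<not> kazhdan_subset (range n)"
proof (rule not_kazhdan_subsetI)
  fix \<epsilon> :: real assume "\<epsilon> > 0"
  \<comment> \<open>The squared distances sum to at most 6 whatever \<open>N\<close> is: 2 from the
    geometric terms and 4 from the exceptional index. Averaging over many coordinates makes this
    small.\<close>
  obtain N :: nat where N: "6 / \<epsilon>\<^sup>2 < real N" using reals_Archimedean2 by blast
  have "0 < 6 / \<epsilon>\<^sup>2" using \<open>\<epsilon> > 0\<close> by simp
  hence "N > 0" using N by (metis less_trans of_nat_0_less_iff)
  have ne1: "cis (\<theta> i) \<noteq> 1" for i
  proof -
    have "\<theta> i \<le> \<theta> 0 * (1/3) ^ i" using lacunary_le[OF l, of 0 i] by simp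
    also have "\<dots> \<le> \<theta> 0" using l by (simp add: lacunary_def mult_left_le power_le_one less_imp_le)
    finally have "\<theta> i < 1" using \<theta>0 by simp
    moreover have "0 < \<theta> i" using l by (simp add: lacunary_def)
    ultimately have "sin (\<theta> i) > 0" using pi_gt3 by (intro sin_gt_zero) auto
    thus ?thesis by (auto simp: complex_eq_iff)
  qed
  have "(\<Sum>i<N. (cmod (cis (\<theta> i) powi n k - 1))\<^sup>2) \<le> real N * \<epsilon>\<^sup>2" for k
  proof -
    obtain j where j: "\<And>i. i \<noteq> j \<Longrightarrow> cmod (cis (\<theta> i) powi n k - 1) \<le> (1/2) ^ i"
      using near by blast
    have "(\<Sum>i<N. (cmod (cis (\<theta> i) powi n k - 1))\<^sup>2) \<le> (\<Sum>i<N. (1/2) ^ i + (if i = j then 4 else 0))"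
    proof (rule sum_mono)
      fix i
      have 2: "cmod (cis (\<theta> i) powi n k - 1) \<le> 2"
        unfolding cis_power_int by (rule cmod_cis_minus_1_le_2)
      have 4: "(cmod (cis (\<theta> i) powi n k - 1))\<^sup>2 \<le> 4"
        using power_mono[OF 2, of 2] by simp
      have 1: "(cmod (cis (\<theta> i) powi n k - 1))\<^sup>2 \<le> (1/2) ^ i" if "i \<noteq> j"
      proof -
        have "(cmod (cis (\<theta> i) powi n k - 1))\<^sup>2 \<le> ((1/2) ^ i)\<^sup>2"
          using j[OF that] by (intro power_mono) auto
        also have "\<dots> \<le> (1/2 :: real) ^ i"
          unfolding power_mult[symmetric] by (intro power_decreasing) auto
        finally show ?thesis .
      qed
      show "(cmod (cis (\<theta> i) powi n k - 1))\<^sup>2 \<le> (1/2) ^ i + (if i = j then 4 else 0)"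
        using 1 4 by (auto intro: add_increasing)
    qed
    also have "\<dots> \<le> 2 + 4"
      unfolding sum.distrib
    proof (rule add_mono)
      show "(\<Sum>i<N. (1/2 :: real) ^ i) \<le> 2"
        using sum_le_suminf[of "\<lambda>i. (1/2 :: real) ^ i" "{..<N}"] geometric_sums[of "1/2 :: real"]
        by (simp add: sums_iff)
    qed (simp add: sum.delta)
    also have "\<dots> \<le> real N * \<epsilon>\<^sup>2" using N \<open>\<epsilon> > 0\<close> by (simp add: field_simps)
    finally show ?thesis .
  qed
  thus "\<exists>N z. N > 0 \<and> (\<forall>i. cmod (z i) = 1 \<and> z i \<noteq> 1) \<and>
             (\<forall>m\<in>range n. (\<Sum>i<N. (cmod (z i powi m - 1))\<^sup>2) \<le> real N * \<epsilon>\<^sup>2)"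
    using \<open>N > 0\<close> ne1 by (intro exI[of _ N] exI[of _ "\<lambda>i. cis (\<theta> i)"]) auto
qed

theorem theorem2p3:
  fixes n :: "nat \<Rightarrow> int"
  assumes "strict_mono n"
    and "closure {z \<in> unit_circle. (\<lambda>k. z powi n k) \<longlonglongrightarrow> 1} = unit_circle"
  shows "(\<forall>\<epsilon>>0. \<exists>\<mu>. circle_prob_measure \<mu> \<and> continuous_measure \<mu> \<and>
            (\<lambda>k. fourier_coeff \<mu> (n k)) \<longlonglongrightarrow> 1 \<and>
            (SUP k. cmod (fourier_coeff \<mu> (n k) - 1)) < \<epsilon>) \<and>
         \<not> kazhdan_subset (range n)"
proof -
  \<comment> \<open>One sequence of angles, chosen independently of \<open>\<epsilon>\<close>,
    serves both conclusions.\<close>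
  obtain \<theta> where \<theta>: "lacunary \<theta>" "\<theta> 0 < 1"
    and lim: "\<And>j. (\<lambda>k. cis (\<theta> j) powi n k) \<longlonglongrightarrow> 1"
    and near: "\<And>k. \<exists>j. \<forall>i. i \<noteq> j \<longrightarrow> cmod (cis (\<theta> i) powi n k - 1) \<le> (1/2) ^ i"
    using almost_all_factors_near_1[OF assms(2)] by blast
  show ?thesis
    using exists_continuous_measure_fourier_near_1[OF \<theta> lim near]
      lacunary_angles_not_kazhdan[of \<theta> n, OF \<theta> near] by blast
qed

end
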